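(* Let $\lambda$ be a nonzero real number and let $r>1$ be an integer. For every integer $k\ge 1$, $$H_{k,\lambda}^{(r)}=\frac{1}{k!}\bigg(\frac{\langle r\rangle_{k}-\langle r-\lambda\rangle_{k}}{\lambda}\bigg)=\frac{1}{\lambda}\bigg(\binom{r+k-1}{k}-\binom{r+k-\lambda-1}{k}\bigg).$$
   Context: Fix a nonzero real $\lambda$. Generating functions are formal power series, with $(1+u)^{a}=\sum_{j\ge0}\binom{a}{j}u^{j}$, where $\binom{a}{j}=\frac{a(a-1)\cdots(a-j+1)}{j!}$ for real $a$. Notation: $\langle\alpha\rangle_0=1$ and $\langle\alpha\rangle_k=\alpha(\alpha+1)\cdots(\alpha+k-1)$ for $k\ge1$. Degenerate logarithm: $\log_{\lambda}(1+t)=\frac{1}{\lambda}\big((1+t)^{\lambda}-1\big)$. Degenerate harmonic numbers $H_{n,\lambda}$: defined by $-\frac{\log_{\lambda}(1-t)}{1-t}=\sum_{n=1}^{\infty}H_{n,\lambda}t^{n}$. Degenerate hyperharmonic numbers: $H_{0,\lambda}^{(r)}=0$ $(r\ge1)$, $H_{n,\lambda}^{(1)}=H_{n,\lambda}$, and $H_{n,\lambda}^{(r)}=\sum_{k=1}^{n}H_{k,\lambda}^{(r-1)}$ for $r\ge2$, $n\ge1$; equivalently $-\frac{\log_{\lambda}(1-t)}{(1-t)^{r}}=\sum_{n=1}^{\infty}H_{n,\lambda}^{(r)}t^{n}$. *)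

theory Defs
  imports Complex_Main "HOL-Computational_Algebra.Formal_Power_Series"
begin

(* The series log_lambda(1 + t), with (1 + t)^lambda the binomial series. *)
definition fps_degenerate_log :: "real \<Rightarrow> real fps" where
  "fps_degenerate_log lam = fps_const (1 / lam) * (fps_binomial lam - 1)"

(* The composition with - fps_X gives log_lambda(1 - t). The constant coefficient of the
   quotient is 0, in accordance with the generating function starting at n = 1. *)
definition degenerate_harmonic :: "real \<Rightarrow> nat \<Rightarrow> real" where
  "degenerate_harmonic lam n =
     fps_nth (- (fps_degenerate_log lam oo - fps_X) / (1 - fps_X)) n"

(* The second argument is the order r >= 1; order 0 is left unspecified. *)
fun degenerate_hyperharmonic :: "real \<Rightarrow> nat \<Rightarrow> nat \<Rightarrow> real" where
  "degenerate_hyperharmonic lam (Suc 0) n =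
     (if n = 0 then 0 else degenerate_harmonic lam n)"
| "degenerate_hyperharmonic lam (Suc (Suc r)) n =
     (if n = 0 then 0 else \<Sum>k=1..n. degenerate_hyperharmonic lam (Suc r) k)"

end

theory Submission
  imports Defs
begin

text \<open>
  The number \<open>pochhammer a n / fact n\<close> is the coefficient of \<open>t^n\<close> in the power series
  \<open>(1 - t)^(-a)\<close>. Since \<open>-log_\<lambda>(1 - t) = (1 - (1 - t)^\<lambda>) / \<lambda>\<close>, dividing by \<open>(1 - t)^r\<close> gives
  \<open>((1 - t)^(-r) - (1 - t)^(-(r - \<lambda>))) / \<lambda>\<close>, whose coefficients are the claimed ones.

  On the level of coefficients, division by \<open>1 - t\<close> is the passage to partial sums, and it raises
  the exponent \<open>a\<close> by one (\<open>sum_pochhammer_div_fact\<close>). This single identity evaluates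
  the degenerate harmonic numbers, which are partial sums of the coefficients of
  \<open>-log_\<lambda>(1 - t)\<close>, and it is also the induction step in the order \<open>r\<close>. The second equality of
  the theorem only rewrites rising factorials as generalised binomial coefficients.
\<close>

text \<open>
  This is the coefficient form of \<open>(1 - t)^(-a) / (1 - t) = (1 - t)^(-(a + 1))\<close>. In the induction,
  both new terms are multiples of \<open>pochhammer (a + 1) n\<close>, with factors \<open>n + 1\<close> and \<open>a\<close>
  over \<open>fact (n + 1)\<close>.
\<close>
lemma sum_pochhammer_div_fact:
  fixes a :: "'a :: field_char_0"
  shows "(\<Sum>j\<le>n. pochhammer a j / fact j) = pochhammer (a + 1) n / fact n"
proof (induction n)
  case 0
  show ?case by simp
next
  case (Suc n)
  have nz: "(1 + of_nat n :: 'a) \<noteq> 0"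
    by (metis of_nat_Suc of_nat_neq_0)
  have "(\<Sum>j\<le>Suc n. pochhammer a j / fact j)
      = pochhammer (a + 1) n / fact n + a * pochhammer (a + 1) n / fact (Suc n)"
    by (simp add: Suc pochhammer_rec)
  also have "\<dots> = pochhammer (a + 1) n * (a + 1 + of_nat n) / fact (Suc n)"
    using nz by (simp add: divide_simps) (simp add: algebra_simps)
  finally show ?case
    by (simp add: pochhammer_Suc)
qed

lemma fps_nth_binomial_compose_uminus_X:
  fixes a :: "'a :: field_char_0"
  shows "fps_nth (fps_binomial a oo - fps_X) n = pochhammer (- a) n / fact n"
  by (simp add: fps_compose_uminus' gbinomial_pochhammer)

lemma degenerate_harmonic_eq:
  "degenerate_harmonic lam n = (1 - pochhammer (1 - lam) n / fact n) / lam"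
proof -
  let ?c = "\<lambda>a j. pochhammer a j / fact j :: real"
  have "degenerate_harmonic lam n = (\<Sum>j\<le>n. fps_nth (- (fps_degenerate_log lam oo - fps_X)) j)"
    unfolding degenerate_harmonic_def
    by (simp add: fps_divide_fps_X_minus1_sum atLeast0AtMost)
  \<comment> \<open>The constant series \<open>1\<close> is \<open>(1 - t)^0\<close>, so the partial-sum identity applies to it as well.\<close>
  also have "\<dots> = (\<Sum>j\<le>n. (?c 0 j - ?c (- lam) j) / lam)"
    by (intro sum.cong refl)
       (auto simp: fps_degenerate_log_def fps_compose_mult_distrib fps_compose_sub_distrib
          fps_nth_binomial_compose_uminus_X pochhammer_0_left diff_divide_distrib)
  also have "\<dots> = (?c 1 n - ?c (1 - lam) n) / lam"
    using sum_pochhammer_div_fact[of "0 :: real" n] sum_pochhammer_div_fact[of "- lam" n]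
    by (simp add: sum_subtractf flip: sum_divide_distrib)
  finally show ?thesis
    by (simp add: flip: pochhammer_fact)
qed

text \<open>
  The formula also holds at \<open>n = 0\<close>, where both sides vanish. Hence the defining sums, which start
  at \<open>1\<close>, are full partial sums and the partial-sum identity raises the order by one.
\<close>
lemma degenerate_hyperharmonic_Suc_eq:
  "degenerate_hyperharmonic lam (Suc r) n
     = (pochhammer (real (Suc r)) n / fact n - pochhammer (real (Suc r) - lam) n / fact n) / lam"
proof (induction r arbitrary: n)
  case 0
  show ?case
    by (simp add: degenerate_harmonic_eq flip: pochhammer_fact)
next
  case (Suc r)
  have "degenerate_hyperharmonic lam (Suc (Suc r)) n
      = (\<Sum>j\<le>n. degenerate_hyperharmonic lam (Suc r) j)"
  proof -
    have "degenerate_hyperharmonic lam (Suc r) 0 = 0"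
      by (simp add: Suc)
    then show ?thesis
      by (simp add: atMost_atLeast0 sum.atLeast_Suc_atMost)
  qed
  also have "\<dots> = (pochhammer (real (Suc r) + 1) n / fact n
      - pochhammer (real (Suc r) - lam + 1) n / fact n) / lam"
    unfolding Suc
    by (simp only: sum_subtractf sum_pochhammer_div_fact flip: sum_divide_distrib)
  finally show ?case
    by (simp add: algebra_simps)
qed

theorem theorem12:
  fixes lam :: real and r k :: nat
  assumes "lam \<noteq> 0" and "r > 1" and "k \<ge> 1"
  shows "degenerate_hyperharmonic lam r k
           = 1 / fact k * ((pochhammer (real r) k - pochhammer (real r - lam) k) / lam)
       \<and> 1 / fact k * ((pochhammer (real r) k - pochhammer (real r - lam) k) / lam)
           = 1 / lam * (((real r + real k - 1) gchoose k)
                        - ((real r + real k - lam - 1) gchoose k))"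
proof
  obtain s where "r = Suc s"
    using assms(2) by (cases r) auto
  then show "degenerate_hyperharmonic lam r k
      = 1 / fact k * ((pochhammer (real r) k - pochhammer (real r - lam) k) / lam)"
    by (simp only: degenerate_hyperharmonic_Suc_eq) (simp add: diff_divide_distrib mult.commute)
  show "1 / fact k * ((pochhammer (real r) k - pochhammer (real r - lam) k) / lam)
      = 1 / lam * (((real r + real k - 1) gchoose k) - ((real r + real k - lam - 1) gchoose k))"
    by (simp add: gbinomial_pochhammer' algebra_simps diff_divide_distrib)
qed

end
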